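(* Let $i:E\hookrightarrow F$ be an injective morphism of effect algebras, and let $\sigma:E\to[0,1]$ be a state. The following are equivalent: 1. The state $\sigma$ extends to a state $\tau$ on $F$, for which $\tau\circ i=\sigma$. 2. The state $\sigma$, viewed as an element of $\mathrm{H}^1_\le(E)$, lies in the precone of the connecting homomorphism $\partial:\mathrm{H}^1_\le(E)\to\mathrm{H}^2_\le(F,E)$, i.e. $\partial(\sigma)\ge 0$ in the pre-order of $\mathrm{H}^2_\le(F,E)$.
   Context: An effect algebra is a set $E$ with a partial binary operation $\boxplus$, a unary operation $(-)^\bot$ and elements $0,1\in E$ such that: if $a\boxplus b$ is defined then so is $b\boxplus a$ and they are equal; if $a\boxplus b$ and $(a\boxplus b)\boxplus c$ are defined then so are $b\boxplus c$ and $a\boxplus(b\boxplus c)$, and $(a\boxplus b)\boxplus c=a\boxplus(b\boxplus c)$; $0\boxplus a$ is always defined and equals $a$; for each $a$, $a^\bot$ is the unique element with $a\boxplus a^\bot=1$; if $a\boxplus 1$ is defined then $a=0$. A morphism preserves $0$, $1$, complements, and whenever $a\boxplus b$ is defined, $f(a)\boxplus f(b)$ is defined and equals $f(a\boxplus b)$. A state on $E$ is a morphism $E\to[0,1]$, where $[0,1]\subseteq\mathbb{R}$ has partial addition and $a^\bot=1-a$. Ordered homological algebra: an ordered abelian group is an abelian group with a compatible partial order. A cochain complex of ordered abelian groups is a sequence $A^0\xrightarrow{\delta}A^1\xrightarrow{\delta}\cdots$ of ordered abelian groups and (not necessarily positive) homomorphisms with $\delta\circ\delta=0$. The precone of a map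 $f$ into a (pre-)ordered object is $\mathrm{prec}(f)=\{x\mid f(x)\ge0\}$. Put $\mathcal{Z}^n_\le(A)=\mathrm{prec}(\delta:A^n\to A^{n+1})$ and $\mathrm{H}^n_\le(A)=\mathcal{Z}^n_\le(A)/\mathrm{im}(\delta)$ (so $a\sim a'$ iff $a-a'\in\mathrm{im}(\delta)$), a commutative monoid. For a surjective positive morphism of cochain complexes $p:B^\bullet\to A^\bullet$, the relative cocycles are $\mathcal{Z}^n_\le(B,A)=\{b\in B^n\mid\delta(b)\ge0,\ p(b)\ge0\}$, with $a\sim b$ iff there is $c\in B^{n-1}$ with $a-b=\delta(c)$ and $p(c)=0$, and $\mathrm{H}^n_\le(B,A)=\mathcal{Z}^n_\le(B,A)/\sim$. It is pre-ordered by $[a]\le[b]$ iff there is $c\in B^{n-1}$ with $a+\delta(c)\le b$ and $p(c)=0$. The connecting homomorphism $\partial:\mathrm{H}^n_\le(A)\to\mathrm{H}^{n+1}_\le(B,A)$ sends the class of $a\in\mathcal{Z}^n_\le(A)$ to the class of $\delta(b)$, for any $b\in B^n$ with $p(b)=a$ (well defined). Order cohomology of an effect algebra $E$ (coefficients $\mathbb{R}$): let $T_n(E)=\{(a_0,\dots,a_n)\in E^{n+1}\mid a_0\boxplus\cdots\boxplus a_n\text{ is defined and equals }1\}$ and $C^n(E)=\mathbb{R}^{T_n(E)}$ for $n\ge0$, $C^{-1}(E)=0$, with pointwise order and coboundary $$(\delta\alpha)(a_0,\dots,a_{n+1})=\sum_{k=0}^{n}(-1)^k\alpha(a_0,\dots,a_k\boxplus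 a_{k+1},\dots,a_{n+1})+(-1)^{n+1}\alpha(a_{n+1}\boxplus a_0,a_1,\dots,a_n).$$ Let $\mathcal{C}^n(E)=C^n(E)\times C^{n-1}(E)$ as an abelian group, ordered by the positive cone $\{0\}\times\{\psi\in C^{n-1}(E)\mid\psi\ge0\}$, with coboundary $\delta^{\mathcal{C}}(\varphi,\psi)=(\delta\varphi,\varphi-\delta\psi)$. This is a cochain complex of ordered abelian groups, and $\mathrm{H}^n_\le(E)$ denotes its $n$-th order cohomology monoid. Identifying $(a_0,a_1)\in T_1(E)$ with $a_1\in E$, one has $\mathrm{H}^1_\le(E)\cong\{\varphi:E\to\mathbb{R}_{\ge0}\mid\varphi(a\boxplus b)=\varphi(a)+\varphi(b)\text{ whenever }a\boxplus b\text{ is defined}\}$, the map $\varphi$ corresponding to the class of $(\varphi,0)\in\mathcal{C}^1(E)$; in this way a state $\sigma$ on $E$ is an element of $\mathrm{H}^1_\le(E)$. For an injective morphism $i:E\hookrightarrow F$, restriction along the induced injections $T_n(E)\to T_n(F)$ gives a surjective positive morphism $p:\mathcal{C}^\bullet(F)\to\mathcal{C}^\bullet(E)$; $\mathrm{H}^n_\le(F,E)$ and $\partial$ are the relative cohomology and connecting homomorphism for this $p$. *)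

theory Defs
  imports Complex_Main "HOL-Library.Function_Algebras" "HOL-Library.Product_Plus"
begin

section \<open>Effect algebras and states\<close>

record 'a effect_alg =
  carrier :: "'a set"
  osum :: "'a \<Rightarrow> 'a \<Rightarrow> 'a option"
  compl :: "'a \<Rightarrow> 'a"
  zero :: 'a
  one :: 'a

text \<open>The partial operation is option-valued: \<open>osum E a b = Some c\<close> says that the sum of \<open>a\<close> and
  \<open>b\<close> is defined and equals \<open>c\<close>, and \<open>osum E a b = None\<close> that it is undefined.\<close>

locale effect_algebra =
  fixes E :: "'a effect_alg"
  assumes osum_closed:
      "\<lbrakk>a \<in> carrier E; b \<in> carrier E; osum E a b = Some c\<rbrakk> \<Longrightarrow> c \<in> carrier E"
    and compl_closed: "a \<in> carrier E \<Longrightarrow> compl E a \<in> carrier E"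
    and zero_closed: "zero E \<in> carrier E"
    and one_closed: "one E \<in> carrier E"
    and osum_commute:
      "\<lbrakk>a \<in> carrier E; b \<in> carrier E; osum E a b = Some c\<rbrakk> \<Longrightarrow> osum E b a = Some c"
    and osum_assoc:
      "\<lbrakk>a \<in> carrier E; b \<in> carrier E; c \<in> carrier E; osum E a b = Some d; osum E d c = Some e\<rbrakk>
       \<Longrightarrow> \<exists>f. osum E b c = Some f \<and> osum E a f = Some e"
    and osum_zero: "a \<in> carrier E \<Longrightarrow> osum E (zero E) a = Some a"
    and osum_compl: "a \<in> carrier E \<Longrightarrow> osum E a (compl E a) = Some (one E)"
    and compl_unique:
      "\<lbrakk>a \<in> carrier E; b \<in> carrier E; osum E a b = Some (one E)\<rbrakk> \<Longrightarrow> b = compl E a"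
    and osum_one: "\<lbrakk>a \<in> carrier E; osum E a (one E) \<noteq> None\<rbrakk> \<Longrightarrow> a = zero E"

definition ea_morphism :: "'a effect_alg \<Rightarrow> 'b effect_alg \<Rightarrow> ('a \<Rightarrow> 'b) \<Rightarrow> bool" where
  "ea_morphism E F f \<longleftrightarrow>
     f ` carrier E \<subseteq> carrier F \<and>
     f (zero E) = zero F \<and>
     f (one E) = one F \<and>
     (\<forall>a\<in>carrier E. f (compl E a) = compl F (f a)) \<and>
     (\<forall>a\<in>carrier E. \<forall>b\<in>carrier E. \<forall>c. osum E a b = Some c \<longrightarrow> osum F (f a) (f b) = Some (f c))"

definition unit_interval :: "real effect_alg" where
  "unit_interval =
     \<lparr>carrier = {0..1},
      osum = (\<lambda>a b. if a + b \<le> 1 then Some (a + b) else None),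
      compl = (\<lambda>a. 1 - a),
      zero = 0,
      one = 1\<rparr>"

definition ea_state :: "'a effect_alg \<Rightarrow> ('a \<Rightarrow> real) \<Rightarrow> bool" where
  "ea_state E s \<longleftrightarrow> ea_morphism E unit_interval s"


section \<open>Ordered homological algebra\<close>

text \<open>The data of a non-negatively graded cochain complex of ordered abelian groups: a subgroup
  \<open>grp A n\<close> of an ambient abelian group, which supplies \<open>+\<close>, \<open>-\<close> and \<open>0\<close>, a partial order \<open>leq A n\<close>
  on it, and a homomorphism \<open>cobd A n\<close> from \<open>grp A n\<close> to \<open>grp A (Suc n)\<close>. The record does not carry
  the axioms. A morphism of complexes is a family \<open>p\<close> of maps \<open>p n\<close>.\<close>

record 'g ocomplex =
  grp :: "nat \<Rightarrow> 'g set"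
  leq :: "nat \<Rightarrow> 'g \<Rightarrow> 'g \<Rightarrow> bool"
  cobd :: "nat \<Rightarrow> 'g \<Rightarrow> 'g"

definition precone :: "'x set \<Rightarrow> ('y \<Rightarrow> 'y \<Rightarrow> bool) \<Rightarrow> 'y \<Rightarrow> ('x \<Rightarrow> 'y) \<Rightarrow> 'x set" where
  "precone X le z f = {x \<in> X. le z (f x)}"

definition cocycles :: "'g::ab_group_add ocomplex \<Rightarrow> nat \<Rightarrow> 'g set" where
  "cocycles A n = precone (grp A n) (leq A (Suc n)) 0 (cobd A n)"

text \<open>Complexes vanish in degree \<open>-1\<close>, hence the zero image in degree \<open>0\<close>.\<close>

definition coboundaries :: "'g::ab_group_add ocomplex \<Rightarrow> nat \<Rightarrow> 'g set" where
  "coboundaries A n = (case n of 0 \<Rightarrow> {0} | Suc m \<Rightarrow> cobd A m ` grp A m)"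

definition cohom_rel :: "'g::ab_group_add ocomplex \<Rightarrow> nat \<Rightarrow> ('g \<times> 'g) set" where
  "cohom_rel A n =
     {(a, a'). a \<in> cocycles A n \<and> a' \<in> cocycles A n \<and> a - a' \<in> coboundaries A n}"

definition cohom_class :: "'g::ab_group_add ocomplex \<Rightarrow> nat \<Rightarrow> 'g \<Rightarrow> 'g set" where
  "cohom_class A n a = cohom_rel A n `` {a}"

definition cohom :: "'g::ab_group_add ocomplex \<Rightarrow> nat \<Rightarrow> 'g set set" where
  "cohom A n = cocycles A n // cohom_rel A n"

definition rel_cocycles ::
  "'h::ab_group_add ocomplex \<Rightarrow> 'g::ab_group_add ocomplex \<Rightarrow> (nat \<Rightarrow> 'h \<Rightarrow> 'g) \<Rightarrow> nat \<Rightarrow> 'h set" where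
  "rel_cocycles B A p n = {b \<in> grp B n. leq B (Suc n) 0 (cobd B n b) \<and> leq A n 0 (p n b)}"

definition rel_coboundaries ::
  "'h::ab_group_add ocomplex \<Rightarrow> (nat \<Rightarrow> 'h \<Rightarrow> 'g::ab_group_add) \<Rightarrow> nat \<Rightarrow> 'h set" where
  "rel_coboundaries B p n =
     (case n of 0 \<Rightarrow> {0} | Suc m \<Rightarrow> {cobd B m c | c. c \<in> grp B m \<and> p m c = 0})"

definition rel_cohom_rel ::
  "'h::ab_group_add ocomplex \<Rightarrow> 'g::ab_group_add ocomplex \<Rightarrow> (nat \<Rightarrow> 'h \<Rightarrow> 'g) \<Rightarrow> nat
     \<Rightarrow> ('h \<times> 'h) set" where
  "rel_cohom_rel B A p n =
     {(a, b). a \<in> rel_cocycles B A p n \<and> b \<in> rel_cocycles B A p n \<and>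
              a - b \<in> rel_coboundaries B p n}"

definition rel_cohom_class ::
  "'h::ab_group_add ocomplex \<Rightarrow> 'g::ab_group_add ocomplex \<Rightarrow> (nat \<Rightarrow> 'h \<Rightarrow> 'g) \<Rightarrow> nat
     \<Rightarrow> 'h \<Rightarrow> 'h set" where
  "rel_cohom_class B A p n b = rel_cohom_rel B A p n `` {b}"

definition rel_cohom ::
  "'h::ab_group_add ocomplex \<Rightarrow> 'g::ab_group_add ocomplex \<Rightarrow> (nat \<Rightarrow> 'h \<Rightarrow> 'g) \<Rightarrow> nat
     \<Rightarrow> 'h set set" where
  "rel_cohom B A p n = rel_cocycles B A p n // rel_cohom_rel B A p n"

definition rel_cohom_leq ::
  "'h::ab_group_add ocomplex \<Rightarrow> 'g::ab_group_add ocomplex \<Rightarrow> (nat \<Rightarrow> 'h \<Rightarrow> 'g) \<Rightarrow> nat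
     \<Rightarrow> 'h set \<Rightarrow> 'h set \<Rightarrow> bool" where
  "rel_cohom_leq B A p n X Y \<longleftrightarrow>
     X \<in> rel_cohom B A p n \<and> Y \<in> rel_cohom B A p n \<and>
     (\<exists>a\<in>X. \<exists>b\<in>Y. \<exists>d\<in>rel_coboundaries B p n. leq B n (a + d) b)"

text \<open>The class of \<open>cobd B n b\<close> does not depend on the choice of a lift \<open>b\<close> of a representative.\<close>

definition connecting ::
  "'h::ab_group_add ocomplex \<Rightarrow> 'g::ab_group_add ocomplex \<Rightarrow> (nat \<Rightarrow> 'h \<Rightarrow> 'g) \<Rightarrow> nat
     \<Rightarrow> 'g set \<Rightarrow> 'h set" where
  "connecting B A p n X =
     (THE Y. \<exists>b\<in>grp B n. p n b \<in> X \<and> Y = rel_cohom_class B A p (Suc n) (cobd B n b))"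


section \<open>Order cohomology of effect algebras\<close>

fun osum_list :: "'a effect_alg \<Rightarrow> 'a list \<Rightarrow> 'a option" where
  "osum_list E [] = Some (zero E)"
| "osum_list E [a] = Some a"
| "osum_list E (a # b # as) = Option.bind (osum E a b) (\<lambda>c. osum_list E (c # as))"

definition tests :: "'a effect_alg \<Rightarrow> nat \<Rightarrow> 'a list set" where
  "tests E n =
     {as. length as = Suc n \<and> set as \<subseteq> carrier E \<and> osum_list E as = Some (one E)}"

text \<open>A real function on \<open>tests E n\<close> is represented by its extension by zero to all lists, so that
  addition and order are those of the function type.\<close>

definition cochains :: "'a effect_alg \<Rightarrow> nat \<Rightarrow> ('a list \<Rightarrow> real) set" where
  "cochains E n = {\<alpha>. \<forall>as. as \<notin> tests E n \<longrightarrow> \<alpha> as = 0}"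

definition face :: "'a effect_alg \<Rightarrow> nat \<Rightarrow> 'a list \<Rightarrow> 'a list" where
  "face E k as = take k as @ [the (osum E (as ! k) (as ! Suc k))] @ drop (k + 2) as"

definition cyclic_face :: "'a effect_alg \<Rightarrow> 'a list \<Rightarrow> 'a list" where
  "cyclic_face E as = the (osum E (last as) (hd as)) # butlast (tl as)"

definition coboundary :: "'a effect_alg \<Rightarrow> nat \<Rightarrow> ('a list \<Rightarrow> real) \<Rightarrow> 'a list \<Rightarrow> real" where
  "coboundary E n \<alpha> =
     (\<lambda>as. if as \<in> tests E (Suc n)
           then (\<Sum>k=0..n. (-1) ^ k * \<alpha> (face E k as)) + (-1) ^ Suc n * \<alpha> (cyclic_face E as)
           else 0)"

text \<open>\<open>cochains_prev E n\<close> and \<open>coboundary_prev E n\<close> are the cochain group in degree \<open>n - 1\<close> and the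
  coboundary from degree \<open>n - 1\<close> to degree \<open>n\<close>; both vanish for \<open>n = 0\<close>.\<close>

definition cochains_prev :: "'a effect_alg \<Rightarrow> nat \<Rightarrow> ('a list \<Rightarrow> real) set" where
  "cochains_prev E n = (case n of 0 \<Rightarrow> {0} | Suc m \<Rightarrow> cochains E m)"

definition coboundary_prev :: "'a effect_alg \<Rightarrow> nat \<Rightarrow> ('a list \<Rightarrow> real) \<Rightarrow> 'a list \<Rightarrow> real" where
  "coboundary_prev E n \<psi> = (case n of 0 \<Rightarrow> 0 | Suc m \<Rightarrow> coboundary E m \<psi>)"

definition order_complex ::
  "'a effect_alg \<Rightarrow> (('a list \<Rightarrow> real) \<times> ('a list \<Rightarrow> real)) ocomplex" where
  "order_complex E =
     \<lparr>grp = (\<lambda>n. cochains E n \<times> cochains_prev E n),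
      leq = (\<lambda>n x y. y - x \<in> {0} \<times> {\<psi> \<in> cochains_prev E n. 0 \<le> \<psi>}),
      cobd = (\<lambda>n (\<phi>, \<psi>). (coboundary E n \<phi>, \<phi> - coboundary_prev E n \<psi>))\<rparr>"

definition restrict_cochain ::
  "'a effect_alg \<Rightarrow> ('a \<Rightarrow> 'b) \<Rightarrow> nat \<Rightarrow> ('b list \<Rightarrow> real) \<Rightarrow> 'a list \<Rightarrow> real" where
  "restrict_cochain E i n \<alpha> = (\<lambda>as. if as \<in> tests E n then \<alpha> (map i as) else 0)"

definition order_restrict ::
  "'a effect_alg \<Rightarrow> ('a \<Rightarrow> 'b) \<Rightarrow> nat \<Rightarrow> ('b list \<Rightarrow> real) \<times> ('b list \<Rightarrow> real)
     \<Rightarrow> ('a list \<Rightarrow> real) \<times> ('a list \<Rightarrow> real)" where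
  "order_restrict E i n =
     (\<lambda>(\<phi>, \<psi>). (restrict_cochain E i n \<phi>,
                case n of 0 \<Rightarrow> 0 | Suc m \<Rightarrow> restrict_cochain E i m \<psi>))"

text \<open>The element of the first order cohomology given by an additive function \<open>\<phi>\<close>, where the pair
  \<open>[a0, a1]\<close> is identified with \<open>a1\<close>.\<close>

definition additive_class ::
  "'a effect_alg \<Rightarrow> ('a \<Rightarrow> real) \<Rightarrow> (('a list \<Rightarrow> real) \<times> ('a list \<Rightarrow> real)) set" where
  "additive_class E \<phi> =
     cohom_class (order_complex E) 1 (\<lambda>as. if as \<in> tests E 1 then \<phi> (as ! 1) else 0, 0)"

end

theory Submission
  imports Defs
begin

text \<open>For any surjective morphism of ordered cochain complexes, \<open>\<partial>[z] \<ge> 0\<close> holds iff \<open>z\<close> lifts to a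
  cochain \<open>b\<close> with \<open>\<delta> b \<ge> 0\<close>: the relative coboundaries allowed by the pre-order are exactly the
  ambiguity in the choice of a lift. In degree 1 a lift of \<open>(\<sigma>, 0)\<close> is a pair \<open>(\<phi>, \<psi>)\<close> whose second
  component is a function on the single test \<open>(1)\<close>; it vanishes there because \<open>(1)\<close> comes from \<open>E\<close>.
  Then \<open>\<delta>(\<phi>, 0) = (\<delta> \<phi>, \<phi>) \<ge> 0\<close> says that \<open>\<phi>\<close> is additive and non-negative, so
  \<open>a \<mapsto> \<phi> (a\<^sup>\<bottom>, a)\<close> is a state extending \<open>\<sigma>\<close>.\<close>

section \<open>Complexes of ordered groups and the precone of the connecting map\<close>

text \<open>The subgroup property is phrased through 0 and differences, and compatibility of the
  order through \<open>leq_iff_diff\<close>: every comparison becomes positivity of a difference,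
  the form in which coboundaries are compared later.\<close>

locale ordered_cochain_complex =
  fixes A :: "'g::ab_group_add ocomplex"
  assumes zero_mem: "0 \<in> grp A n"
    and diff_mem: "\<lbrakk>x \<in> grp A n; y \<in> grp A n\<rbrakk> \<Longrightarrow> x - y \<in> grp A n"
    and cobd_mem: "x \<in> grp A n \<Longrightarrow> cobd A n x \<in> grp A (Suc n)"
    and cobd_diff: "\<lbrakk>x \<in> grp A n; y \<in> grp A n\<rbrakk> \<Longrightarrow> cobd A n (x - y) = cobd A n x - cobd A n y"
    and cobd_cobd: "x \<in> grp A n \<Longrightarrow> cobd A (Suc n) (cobd A n x) = 0"
    and leq_refl: "x \<in> grp A n \<Longrightarrow> leq A n x x"
    and leq_iff_diff: "\<lbrakk>x \<in> grp A n; y \<in> grp A n\<rbrakk> \<Longrightarrow> leq A n x y \<longleftrightarrow> leq A n 0 (y - x)"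
begin

lemma uminus_mem: "x \<in> grp A n \<Longrightarrow> - x \<in> grp A n"
  using diff_mem[OF zero_mem, of x n] by simp

lemma add_mem: "\<lbrakk>x \<in> grp A n; y \<in> grp A n\<rbrakk> \<Longrightarrow> x + y \<in> grp A n"
  using diff_mem[of x n "- y"] uminus_mem by simp

lemma cobd_zero: "cobd A n 0 = 0"
  using cobd_diff[OF zero_mem zero_mem, of n] by simp

lemma zero_mem_coboundaries: "0 \<in> coboundaries A n"
  using cobd_zero zero_mem by (cases n) (auto simp: coboundaries_def image_iff intro!: bexI[of _ 0])

end

section \<open>Relative cohomology and the connecting homomorphism\<close>

locale surjective_complex_morphism =
  B: ordered_cochain_complex B + A: ordered_cochain_complex A
  for B :: "'h::ab_group_add ocomplex" and A :: "'g::ab_group_add ocomplex" +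
  fixes p :: "nat \<Rightarrow> 'h \<Rightarrow> 'g"
  assumes p_diff: "\<lbrakk>x \<in> grp B n; y \<in> grp B n\<rbrakk> \<Longrightarrow> p n (x - y) = p n x - p n y"
    and p_cobd: "x \<in> grp B n \<Longrightarrow> p (Suc n) (cobd B n x) = cobd A n (p n x)"
    and p_surj: "a \<in> grp A n \<Longrightarrow> \<exists>b\<in>grp B n. p n b = a"
begin

lemma p_zero: "p n 0 = 0"
  using p_diff[OF B.zero_mem B.zero_mem, of n] by simp

lemma rel_coboundaries_Suc:
  "rel_coboundaries B p (Suc n) = cobd B n ` {c \<in> grp B n. p n c = 0}"
  by (auto simp: rel_coboundaries_def)

lemma zero_mem_rel_coboundaries: "0 \<in> rel_coboundaries B p (Suc n)"
  unfolding rel_coboundaries_Suc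
  by (rule image_eqI[of _ _ 0]) (auto simp: B.cobd_zero B.zero_mem p_zero)

lemma diff_mem_rel_coboundaries:
  assumes "x \<in> rel_coboundaries B p (Suc n)" "y \<in> rel_coboundaries B p (Suc n)"
  shows "x - y \<in> rel_coboundaries B p (Suc n)"
proof -
  obtain c d where *: "c \<in> grp B n" "p n c = 0" "x = cobd B n c" "d \<in> grp B n" "p n d = 0" "y = cobd B n d"
    using assms unfolding rel_coboundaries_Suc by auto
  then show ?thesis
    unfolding rel_coboundaries_Suc
    by (intro image_eqI[of _ _ "c - d"]) (auto simp: B.cobd_diff B.diff_mem p_diff)
qed

lemma equiv_rel_cohom_rel: "equiv (rel_cocycles B A p (Suc n)) (rel_cohom_rel B A p (Suc n))"
proof (rule equivI)
  show "rel_cohom_rel B A p (Suc n) \<subseteq> rel_cocycles B A p (Suc n) \<times> rel_cocycles B A p (Suc n)"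
    by (auto simp: rel_cohom_rel_def)
  show "refl_on (rel_cocycles B A p (Suc n)) (rel_cohom_rel B A p (Suc n))"
    by (auto simp: refl_on_def rel_cohom_rel_def zero_mem_rel_coboundaries)
  show "sym (rel_cohom_rel B A p (Suc n))"
    using diff_mem_rel_coboundaries[OF zero_mem_rel_coboundaries]
    by (fastforce simp: sym_def rel_cohom_rel_def)
  show "trans (rel_cohom_rel B A p (Suc n))"
  proof (rule transI)
    fix x y z
    assume "(x, y) \<in> rel_cohom_rel B A p (Suc n)" "(y, z) \<in> rel_cohom_rel B A p (Suc n)"
    \<comment> \<open>Relative coboundaries are known to contain 0 and to be closed under
      differences, so the sum of x - y and y - z is written with differences only.\<close>
    moreover from this have "(x - y) - (0 - (y - z)) \<in> rel_coboundaries B p (Suc n)"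
      by (intro diff_mem_rel_coboundaries[OF _ diff_mem_rel_coboundaries[OF zero_mem_rel_coboundaries]])
        (auto simp: rel_cohom_rel_def)
    ultimately show "(x, z) \<in> rel_cohom_rel B A p (Suc n)"
      by (simp add: rel_cohom_rel_def)
  qed
qed

text \<open>The first positivity condition is the reflexive 0 \<le> 0, because the square of the
  coboundary vanishes; the second is the cocycle condition on \<open>p n b\<close>, because p
  commutes with coboundaries.\<close>

lemma cobd_mem_rel_cocycles:
  assumes "b \<in> grp B n" "p n b \<in> cocycles A n"
  shows "cobd B n b \<in> rel_cocycles B A p (Suc n)"
  using assms
  by (auto simp: rel_cocycles_def cocycles_def precone_def B.cobd_mem B.cobd_cobd p_cobd
      B.leq_refl B.zero_mem)

lemma zero_mem_rel_cocycles: "0 \<in> rel_cocycles B A p n"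
  by (simp add: rel_cocycles_def B.zero_mem B.cobd_zero p_zero A.leq_refl B.leq_refl A.zero_mem)

text \<open>This is the independence of choices behind \<open>connecting\<close>. If the images of b
  and b' differ by the coboundary of c, lift c to d along p: then b - b' - \<open>cobd B m d\<close>
  is killed by p and has the same coboundary as b - b'. In degree 0 the images agree, and b - b'
  itself serves.\<close>

lemma rel_cohom_class_cobd_cong:
  assumes b: "b \<in> grp B n" "p n b \<in> cocycles A n"
    and b': "b' \<in> grp B n" "p n b' \<in> cocycles A n"
    and cob: "p n b - p n b' \<in> coboundaries A n"
  shows "rel_cohom_class B A p (Suc n) (cobd B n b) = rel_cohom_class B A p (Suc n) (cobd B n b')"
proof -
  have "cobd B n b - cobd B n b' \<in> rel_coboundaries B p (Suc n)"
  proof (cases n)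
    case 0
    with cob b b' show ?thesis
      unfolding rel_coboundaries_Suc
      by (intro image_eqI[of _ _ "b - b'"])
         (auto simp: coboundaries_def B.cobd_diff B.diff_mem p_diff)
  next
    case (Suc m)
    with cob obtain c where c: "c \<in> grp A m" "p n b - p n b' = cobd A m c"
      by (auto simp: coboundaries_def)
    then obtain d where d: "d \<in> grp B m" "p m d = c"
      using p_surj by blast
    let ?k = "b - b' - cobd B m d"
    have dn: "cobd B m d \<in> grp B n" and dd: "cobd B n (cobd B m d) = 0"
      using B.cobd_mem B.cobd_cobd d Suc by auto
    have "?k \<in> grp B n" using b b' dn B.diff_mem by blast
    moreover have "p n ?k = 0"
      using b b' dn d c p_cobd[OF d(1)] Suc by (simp add: p_diff B.diff_mem)
    moreover have "cobd B n ?k = cobd B n b - cobd B n b'"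
      using b b' dn dd by (simp add: B.cobd_diff B.diff_mem)
    ultimately show ?thesis
      unfolding rel_coboundaries_Suc by (metis (mono_tags, lifting) image_eqI mem_Collect_eq)
  qed
  then have "(cobd B n b, cobd B n b') \<in> rel_cohom_rel B A p (Suc n)"
    using cobd_mem_rel_cocycles b b' by (simp add: rel_cohom_rel_def)
  then show ?thesis
    unfolding rel_cohom_class_def by (rule equiv_class_eq[OF equiv_rel_cohom_rel])
qed

text \<open>The description in \<open>connecting\<close> is satisfied by b itself and, by the
  preceding independence of choices, by only one class.\<close>

lemma connecting_cohom_class:
  assumes b: "b \<in> grp B n" "p n b \<in> cocycles A n"
  shows "connecting B A p n (cohom_class A n (p n b)) =
    rel_cohom_class B A p (Suc n) (cobd B n b)"
  unfolding connecting_def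
proof (rule the_equality)
  show "\<exists>b'\<in>grp B n. p n b' \<in> cohom_class A n (p n b) \<and>
      rel_cohom_class B A p (Suc n) (cobd B n b) = rel_cohom_class B A p (Suc n) (cobd B n b')"
    using b A.zero_mem_coboundaries
    by (intro bexI[of _ b]) (auto simp: cohom_class_def cohom_rel_def)
  show "Y = rel_cohom_class B A p (Suc n) (cobd B n b)"
    if "\<exists>b'\<in>grp B n. p n b' \<in> cohom_class A n (p n b) \<and>
      Y = rel_cohom_class B A p (Suc n) (cobd B n b')" for Y
    using that b rel_cohom_class_cobd_cong[OF b]
    by (auto simp: cohom_class_def cohom_rel_def)
qed

lemma cohom_class_mem_precone_connecting_iff:
  assumes z: "z \<in> cocycles A n"
  shows "cohom_class A n z \<in>
      precone (cohom A n) (rel_cohom_leq B A p (Suc n)) (rel_cohom_class B A p (Suc n) 0)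
        (connecting B A p n) \<longleftrightarrow>
    (\<exists>b\<in>grp B n. p n b = z \<and> leq B (Suc n) 0 (cobd B n b))"
    (is "?L \<longleftrightarrow> ?R")
proof -
  obtain b where b: "b \<in> grp B n" "p n b = z"
    using z p_surj by (auto simp: cocycles_def precone_def)
  have db: "cobd B n b \<in> rel_cocycles B A p (Suc n)"
    using cobd_mem_rel_cocycles b z by simp
  have db': "cobd B n b \<in> grp B (Suc n)"
    using b B.cobd_mem by simp
  have class_mem: "x \<in> rel_cocycles B A p (Suc n) \<Longrightarrow>
      rel_cohom_class B A p (Suc n) x \<in> rel_cohom B A p (Suc n)" for x
    by (auto simp: rel_cohom_def rel_cohom_class_def intro: quotientI)
  have "?L \<longleftrightarrow> rel_cohom_leq B A p (Suc n) (rel_cohom_class B A p (Suc n) 0)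
      (rel_cohom_class B A p (Suc n) (cobd B n b))"
    using z b connecting_cohom_class[OF b(1)]
    by (auto simp: precone_def cohom_def cohom_class_def intro: quotientI)
  also have "\<dots> \<longleftrightarrow> (\<exists>x\<in>rel_cohom_class B A p (Suc n) 0.
      \<exists>y\<in>rel_cohom_class B A p (Suc n) (cobd B n b).
      \<exists>d\<in>rel_coboundaries B p (Suc n). leq B (Suc n) (x + d) y)" (is "_ \<longleftrightarrow> ?M")
    using class_mem db zero_mem_rel_cocycles by (auto simp: rel_cohom_leq_def)
  also have "?M \<longleftrightarrow> ?R"
  proof
    assume ?M
    then obtain x y d where
      x: "0 - x \<in> rel_coboundaries B p (Suc n)" "x \<in> grp B (Suc n)" and
      y: "cobd B n b - y \<in> rel_coboundaries B p (Suc n)" "y \<in> grp B (Suc n)" and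
      d: "d \<in> rel_coboundaries B p (Suc n)" and le: "leq B (Suc n) (x + d) y"
      by (auto simp: rel_cohom_class_def rel_cohom_rel_def rel_cocycles_def)
    \<comment> \<open>The two changes of representative and d are all relative coboundaries, so
      together they form one coboundary of some c with \<open>p n c = 0\<close>. Subtracting c from
      the lift b absorbs them at once.\<close>
    have "(cobd B n b - y) - ((0 - x) - d) \<in> rel_coboundaries B p (Suc n)"
      using x y d diff_mem_rel_coboundaries by blast
    then obtain c where c: "c \<in> grp B n" "p n c = 0" "cobd B n b - y + x + d = cobd B n c"
      unfolding rel_coboundaries_Suc by (auto simp: algebra_simps)
    have "d \<in> grp B (Suc n)"
      using d B.cobd_mem unfolding rel_coboundaries_Suc by auto
    then have "leq B (Suc n) 0 (y - (x + d))"
      using le B.leq_iff_diff x y B.add_mem by blast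
    also have "y - (x + d) = cobd B n b - cobd B n c"
      unfolding c(3)[symmetric] by simp
    also have "\<dots> = cobd B n (b - c)"
      using b c B.cobd_diff by simp
    finally show ?R
      using b c B.diff_mem p_diff by (intro bexI[of _ "b - c"]) auto
  next
    assume ?R
    then obtain b' where b': "b' \<in> grp B n" "p n b' = z" "leq B (Suc n) 0 (cobd B n b')"
      by auto
    \<comment> \<open>Two lifts of z differ by an element of the kernel of p, so \<open>?d\<close>
      is an admissible correction; it lies below \<open>cobd B n b\<close> because the difference is
      \<open>cobd B n b'\<close>.\<close>
    let ?d = "cobd B n (b - b')"
    have "b - b' \<in> grp B n" "p n (b - b') = 0"
      using b b' B.diff_mem p_diff by auto
    then have d: "?d \<in> rel_coboundaries B p (Suc n)" "?d \<in> grp B (Suc n)"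
      unfolding rel_coboundaries_Suc using B.cobd_mem by auto
    have "cobd B n b - ?d = cobd B n b'"
      using b b' B.cobd_diff by simp
    then have "leq B (Suc n) (0 + ?d) (cobd B n b)"
      using b'(3) B.leq_iff_diff[OF d(2) db'] by simp
    moreover have "0 \<in> rel_cohom_class B A p (Suc n) 0"
      "cobd B n b \<in> rel_cohom_class B A p (Suc n) (cobd B n b)"
      using db zero_mem_rel_cocycles zero_mem_rel_coboundaries
      by (auto simp: rel_cohom_class_def rel_cohom_rel_def)
    ultimately show ?M
      using d(1) by blast
  qed
  finally show ?thesis .
qed

end


section \<open>Faces of tests\<close>

context effect_algebra
begin

text \<open>Undefined sums and elements outside the carrier are absorbed by \<open>None\<close>, so that
  associativity and commutativity hold without side conditions.\<close>

definition oadd :: "'a option \<Rightarrow> 'a option \<Rightarrow> 'a option" where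
  "oadd x y = Option.bind x (\<lambda>a. Option.bind y (\<lambda>b.
     if a \<in> carrier E \<and> b \<in> carrier E then osum E a b else None))"

lemma oadd_Some: "\<lbrakk>a \<in> carrier E; b \<in> carrier E\<rbrakk> \<Longrightarrow> oadd (Some a) (Some b) = osum E a b"
  by (simp add: oadd_def)

lemma oadd_None [simp]: "oadd None y = None" "oadd x None = None"
  by (auto simp: oadd_def Option.bind_eq_None_conv)

lemma oadd_eq_SomeD:
  assumes "oadd x y = Some c"
  obtains a b where "x = Some a" "y = Some b" "a \<in> carrier E" "b \<in> carrier E" "c \<in> carrier E"
    "osum E a b = Some c"
proof -
  obtain a b where "x = Some a" "y = Some b" "a \<in> carrier E" "b \<in> carrier E" "osum E a b = Some c"
    using assms by (auto simp: oadd_def bind_eq_Some_conv split: if_splits)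
  moreover from this have "c \<in> carrier E" using osum_closed by blast
  ultimately show ?thesis using that by blast
qed

lemma oadd_commute_Some: "oadd x y = Some c \<Longrightarrow> oadd y x = Some c"
  by (metis oadd_Some oadd_eq_SomeD osum_commute)

lemma oadd_commute: "oadd x y = oadd y x"
  by (metis not_None_eq oadd_commute_Some)

lemma oadd_assoc_Some:
  assumes "oadd (oadd x y) z = Some e"
  shows "oadd x (oadd y z) = Some e"
proof -
  obtain d c where d: "oadd x y = Some d" and c: "z = Some c" "c \<in> carrier E" "osum E d c = Some e"
    using assms by (rule oadd_eq_SomeD)
  obtain a b where ab: "x = Some a" "y = Some b" "a \<in> carrier E" "b \<in> carrier E" "osum E a b = Some d"
    using d by (rule oadd_eq_SomeD)
  obtain f where f: "osum E b c = Some f" "osum E a f = Some e"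
    using osum_assoc[OF ab(3,4) c(2) ab(5) c(3)] by blast
  moreover have "f \<in> carrier E" using osum_closed[OF ab(4) c(2) f(1)] .
  ultimately show ?thesis using ab c by (simp add: oadd_Some)
qed

text \<open>The axiom transfers definedness from left to right bracketing only. The other direction
  comes from commutativity, by applying it to the reversed sum of z, y, x.\<close>

lemma oadd_assoc: "oadd (oadd x y) z = oadd x (oadd y z)"
proof (cases "oadd x (oadd y z)")
  case None
  then show ?thesis using oadd_assoc_Some[of x y z] by (cases "oadd (oadd x y) z") auto
next
  case (Some e)
  then have "oadd (oadd z y) x = Some e" by (simp add: oadd_commute)
  then have "oadd z (oadd y x) = Some e" by (rule oadd_assoc_Some)
  with Some show ?thesis by (simp add: oadd_commute)
qed

sublocale oadd: abel_semigroup oadd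
  by unfold_locales (rule oadd_assoc, rule oadd_commute)

lemma oadd_zero: "a \<in> carrier E \<Longrightarrow> oadd (Some a) (Some (zero E)) = Some a"
  by (metis oadd_Some oadd_commute osum_zero zero_closed)

text \<open>\<open>osum_list\<close> accumulates from the left; associativity turns this into a
  right fold ending in the neutral element, which is what allows splitting at an arbitrary
  position.\<close>

lemma osum_list_Cons:
  "set (a # as) \<subseteq> carrier E \<Longrightarrow> osum_list E (a # as) = oadd (Some a) (osum_list E as)"
proof (induction as arbitrary: a)
  case Nil
  then show ?case by (simp add: oadd_zero)
next
  case (Cons b as)
  have "osum_list E (a # b # as) = Option.bind (oadd (Some a) (Some b)) (\<lambda>c. osum_list E (c # as))"
    using Cons.prems by (simp add: oadd_Some)
  also have "\<dots> = oadd (oadd (Some a) (Some b)) (osum_list E as)"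
  proof (cases "oadd (Some a) (Some b)")
    case (Some c)
    then have "c \<in> carrier E" by (auto elim: oadd_eq_SomeD)
    with Some Cons show ?thesis by simp
  qed simp
  also have "\<dots> = oadd (Some a) (oadd (Some b) (osum_list E as))"
    by (rule oadd_assoc)
  also have "oadd (Some b) (osum_list E as) = osum_list E (b # as)"
    using Cons.IH[of b] Cons.prems by simp
  finally show ?case .
qed

lemma osum_list_closed: "\<lbrakk>set as \<subseteq> carrier E; osum_list E as = Some c\<rbrakk> \<Longrightarrow> c \<in> carrier E"
  by (cases as) (auto simp: osum_list_Cons zero_closed simp del: osum_list.simps(2,3) elim: oadd_eq_SomeD)

lemma osum_list_append:
  assumes "set xs \<subseteq> carrier E" "set ys \<subseteq> carrier E"
  shows "osum_list E (xs @ ys) = oadd (osum_list E xs) (osum_list E ys)"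
  using assms
proof (induction xs)
  case Nil
  then show ?case
    using osum_list_closed[of ys]
    by (cases "osum_list E ys") (auto simp: oadd_commute[of "Some (zero E)"] oadd_zero)
next
  case (Cons a xs)
  then show ?case
    using osum_list_Cons[of a "xs @ ys"] osum_list_Cons[of a xs] by (simp add: oadd.assoc)
qed

text \<open>Associativity and commutativity bring the adjacent pair to the front as a single
  summand, and a defined sum has defined summands.\<close>

lemma osum_list_Some_oadd:
  assumes "set (xs @ a # b # ys) \<subseteq> carrier E" "osum_list E (xs @ a # b # ys) = Some c"
  obtains d where "oadd (Some a) (Some b) = Some d" "d \<in> carrier E"
proof -
  have "osum_list E (xs @ a # b # ys) =
      oadd (oadd (Some a) (Some b)) (oadd (osum_list E xs) (osum_list E ys))"
    using assms(1) by (simp add: osum_list_append osum_list_Cons oadd.left_commute oadd.assoc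
        del: osum_list.simps(2,3))
  with assms(2) that show ?thesis by (metis oadd_eq_SomeD)
qed

end

text \<open>On a list of length n + 2 the indices k \<le> n give the ordinary faces and k = n + 1
  the cyclic one. Treating the latter as the last face makes the coboundary the usual alternating
  sum over the faces of a semi-simplicial set.\<close>

definition cface :: "'a effect_alg \<Rightarrow> nat \<Rightarrow> 'a list \<Rightarrow> 'a list" where
  "cface E k as = (if Suc k < length as then face E k as else cyclic_face E as)"

lemma cface_append:
  "k = length xs \<Longrightarrow> cface E k (xs @ a # b # ys) = xs @ the (osum E a b) # ys"
  by (simp add: cface_def face_def nth_append)

lemma cface_cyclic:
  "k = Suc (length xs) \<Longrightarrow> cface E k (a # xs @ [b]) = the (osum E b a) # xs"
  by (simp add: cface_def cyclic_face_def)

lemma list_split_pair: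
  assumes "Suc k < length as"
  obtains xs a b ys where "as = xs @ a # b # ys" "length xs = k"
proof
  show "as = take k as @ as ! k # as ! Suc k # drop (k + 2) as"
    using assms by (simp add: Cons_nth_drop_Suc Suc_lessD)
  show "length (take k as) = k" using assms by simp
qed

lemma list_split_ends:
  assumes "2 \<le> length as"
  obtains a xs b where "as = a # xs @ [b]"
proof (cases as)
  case (Cons a ys)
  with assms that show ?thesis by (cases ys rule: rev_cases) auto
qed (use assms in simp)

lemma coboundary_eq_sum:
  assumes "as \<in> tests E (Suc n)"
  shows "coboundary E n \<alpha> as = (\<Sum>k\<le>Suc n. (- 1) ^ k * \<alpha> (cface E k as))"
proof -
  have len: "length as = Suc (Suc n)" using assms by (simp add: tests_def)
  have "(\<Sum>k=0..n. (- 1) ^ k * \<alpha> (face E k as)) = (\<Sum>k\<le>n. (- 1) ^ k * \<alpha> (cface E k as))"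
    using len by (intro sum.cong) (auto simp: cface_def)
  moreover have "cyclic_face E as = cface E (Suc n) as"
    using len by (simp add: cface_def)
  ultimately show ?thesis using assms by (simp add: coboundary_def)
qed

section \<open>Faces of tests and the simplicial identities\<close>

context effect_algebra
begin

text \<open>Rotation moves the last entry next to the first, so that the cyclic merge becomes an
  ordinary merge at the front.\<close>

lemma osum_list_rotate1:
  assumes "set (a # as) \<subseteq> carrier E"
  shows "osum_list E (as @ [a]) = osum_list E (a # as)"
  using assms osum_list_append[of as "[a]"] by (simp add: osum_list_Cons oadd_commute del: osum_list.simps(3))

lemma tests_rotate1: "as @ [a] \<in> tests E n \<Longrightarrow> a # as \<in> tests E n"
  using osum_list_rotate1[of a as] by (auto simp: tests_def)

text \<open>The sum is supplied in two forms: \<open>oadd\<close> for associativity without side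
  conditions, \<open>osum\<close> for evaluating faces.\<close>

lemma tests_merge:
  assumes "xs @ a # b # ys \<in> tests E (Suc n)"
  obtains d where "oadd (Some a) (Some b) = Some d" "osum E a b = Some d"
    "xs @ d # ys \<in> tests E n"
proof -
  have car: "set (xs @ a # b # ys) \<subseteq> carrier E" and
    sum: "osum_list E (xs @ a # b # ys) = Some (one E)" and len: "length (xs @ ys) = n"
    using assms by (auto simp: tests_def)
  obtain d where d: "oadd (Some a) (Some b) = Some d" "d \<in> carrier E"
    using osum_list_Some_oadd[OF car sum] .
  have "osum_list E (xs @ a # b # ys) = osum_list E (xs @ d # ys)"
    using car d by (simp add: osum_list_append osum_list_Cons oadd.assoc[symmetric]
        del: osum_list.simps(2,3))
  with that d car sum len show ?thesis by (auto simp: tests_def oadd_Some)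
qed

lemma tests_merge_cyclic:
  assumes "a # xs @ [b] \<in> tests E (Suc n)"
  obtains d where "oadd (Some b) (Some a) = Some d" "osum E b a = Some d" "d # xs \<in> tests E n"
proof -
  have "[] @ b # a # xs \<in> tests E (Suc n)"
    using assms tests_rotate1[of "a # xs" b] by simp
  then show ?thesis using that by (elim tests_merge) auto
qed

lemma cface_tests:
  assumes "as \<in> tests E (Suc n)" "k \<le> Suc n"
  shows "cface E k as \<in> tests E n"
proof (cases "k = Suc n")
  case True
  have len: "length as = Suc (Suc n)" using assms by (simp add: tests_def)
  then have "2 \<le> length as" by simp
  then obtain a xs b where as: "as = a # xs @ [b]" by (rule list_split_ends)
  with len True assms show ?thesis
    by (auto simp: cface_cyclic elim: tests_merge_cyclic)
next
  case False
  then have "Suc k < length as" using assms by (simp add: tests_def)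
  then obtain xs a b ys where "as = xs @ a # b # ys" "length xs = k" by (rule list_split_pair)
  with assms show ?thesis by (auto simp: cface_append elim: tests_merge)
qed

text \<open>This is the semi-simplicial identity. If the two merged pairs share an entry, both sides
  add up the same three cyclically consecutive entries and agree by associativity; if they are
  disjoint, the two merges do not interact.\<close>

lemma cface_cface:
  assumes as: "as \<in> tests E (Suc (Suc n))" and ij: "i < j" "j \<le> Suc (Suc n)"
  shows "cface E i (cface E j as) = cface E (j - 1) (cface E i as)"
proof -
  have len: "length as = Suc (Suc (Suc n))" using as by (simp add: tests_def)
  then have two: "2 \<le> length as" by simp
  \<comment> \<open>In the first three cases the face j is cyclic: it overlaps the pair of face i at
    the front, at the back, or not at all. In the last two it is ordinary, with adjacent overlapping
    pairs or disjoint ones.\<close>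
  consider "j = Suc (Suc n)" "i = 0" | "j = Suc (Suc n)" "i = Suc n"
    | "j = Suc (Suc n)" "0 < i" "i \<le> n" | "j \<le> Suc n" "j = Suc i" | "j \<le> Suc n" "Suc i < j"
    using ij by linarith
  then show ?thesis
  proof cases
    case 1
    obtain a xs c where 2: "as = a # xs @ [c]" using two by (rule list_split_ends)
    with len obtain b ys where 3: "as = a # b # ys @ [c]" by (cases xs) auto
    obtain d where d: "oadd (Some c) (Some a) = Some d" "osum E c a = Some d"
        "d # b # ys \<in> tests E (Suc n)"
      using tests_merge_cyclic[of a "b # ys" c "Suc n"] as 3 by auto
    obtain d' where d': "oadd (Some a) (Some b) = Some d'" "osum E a b = Some d'"
        "d' # ys @ [c] \<in> tests E (Suc n)"
      using tests_merge[of "[]" a b "ys @ [c]" "Suc n"] as 3 by auto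
    obtain e where e: "oadd (Some d) (Some b) = Some e" "osum E d b = Some e"
      using tests_merge[of "[]" d b "ys" n] d by auto
    obtain e' where e': "oadd (Some c) (Some d') = Some e'" "osum E c d' = Some e'"
      using tests_merge_cyclic[of d' ys c n] d' by auto
    have "e = e'" using d(1) d'(1) e(1) e'(1) by (metis oadd_assoc option.inject)
    then show ?thesis
      using 1 3 len d d' e e' cface_cyclic[of j "b # ys" E a c]
        cface_append[of 0 "[]" E a b "ys @ [c]"] cface_append[of 0 "[]" E d b ys]
        cface_cyclic[of "Suc n" ys E d' c]
      by simp
  next
    case 2
    obtain a xs c where 3: "as = a # xs @ [c]" using two by (rule list_split_ends)
    with len obtain b ys where 4: "as = a # ys @ [b, c]" by (cases xs rule: rev_cases) auto
    obtain d where d: "oadd (Some c) (Some a) = Some d" "osum E c a = Some d"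
        "d # ys @ [b] \<in> tests E (Suc n)"
      using tests_merge_cyclic[of a "ys @ [b]" c "Suc n"] as 4 by auto
    obtain d' where d': "oadd (Some b) (Some c) = Some d'" "osum E b c = Some d'"
        "a # ys @ [d'] \<in> tests E (Suc n)"
      using tests_merge[of "a # ys" b c "[]" "Suc n"] as 4 by auto
    obtain e where e: "oadd (Some b) (Some d) = Some e" "osum E b d = Some e"
      using tests_merge_cyclic[of d ys b n] d by auto
    obtain e' where e': "oadd (Some d') (Some a) = Some e'" "osum E d' a = Some e'"
      using tests_merge_cyclic[of a ys d' n] d' by auto
    have "e = e'" using d(1) d'(1) e(1) e'(1) by (metis oadd_assoc option.inject)
    then show ?thesis
      using 2 4 len d d' e e' cface_cyclic[of j "ys @ [b]" E a c]
        cface_append[of i "a # ys" E b c "[]"] cface_cyclic[of i ys E d b]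
        cface_cyclic[of i ys E a d']
      by simp
  next
    case 3
    obtain a zs f where 4: "as = a # zs @ [f]" using two by (rule list_split_ends)
    \<comment> \<open>Dropping the head a shifts positions by one, so the pair merged by face i
      starts at i - 1 in \<open>zs\<close>.\<close>
    have "Suc (i - 1) < length zs" using 4 len 3 by simp
    then obtain xs b c ys where zs: "zs = xs @ b # c # ys" "length xs = i - 1"
      by (rule list_split_pair)
    then show ?thesis
      using 3 4 len cface_cyclic[of j zs E a f]
        cface_append[of i "a # xs" E b c "ys @ [f]"]
        cface_append[of i "the (osum E f a) # xs" E b c "ys"]
        cface_cyclic[of "j - 1" "xs @ the (osum E b c) # ys" E a f]
      by simp
  next
    case 4
    then have "Suc j < length as" using len by simp
    then obtain zs b c ys where zs: "as = zs @ b # c # ys" "length zs = j"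
      by (rule list_split_pair)
    with 4 obtain xs a where xs: "as = xs @ a # b # c # ys" "length xs = i"
      by (cases zs rule: rev_cases) auto
    obtain d where d: "oadd (Some a) (Some b) = Some d" "osum E a b = Some d"
        "xs @ d # c # ys \<in> tests E (Suc n)"
      using tests_merge[of "xs" a b "c # ys" "Suc n"] as xs by auto
    obtain d' where d': "oadd (Some b) (Some c) = Some d'" "osum E b c = Some d'"
        "xs @ a # d' # ys \<in> tests E (Suc n)"
      using tests_merge[of "xs @ [a]" b c "ys" "Suc n"] as xs by auto
    obtain e where e: "oadd (Some d) (Some c) = Some e" "osum E d c = Some e"
      using tests_merge[of xs d c ys n] d by auto
    obtain e' where e': "oadd (Some a) (Some d') = Some e'" "osum E a d' = Some e'"
      using tests_merge[of xs a d' ys n] d' by auto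
    have "e = e'" using d(1) d'(1) e(1) e'(1) by (metis oadd_assoc option.inject)
    then show ?thesis
      using 4 xs d d' e e' cface_append[of i xs E a b "c # ys"]
        cface_append[of j "xs @ [a]" E b c ys] cface_append[of i xs E d c ys]
        cface_append[of i xs E a d' ys]
      by simp
  next
    case 5
    have "Suc j < length as" using 5 len by simp
    then obtain us c d zs where us: "as = us @ c # d # zs" "length us = j"
      by (rule list_split_pair)
    then have "Suc i < length us" using 5 by simp
    then obtain xs a b ys where xs: "us = xs @ a # b # ys" "length xs = i"
      by (rule list_split_pair)
    moreover from this have "j = Suc (Suc (i + length ys))" using us by simp
    ultimately show ?thesis
      using us cface_append[of j "xs @ a # b # ys" E c d zs]
        cface_append[of i xs E a b "ys @ the (osum E c d) # zs"]
        cface_append[of i xs E a b "ys @ c # d # zs"]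
        cface_append[of "j - 1" "xs @ the (osum E a b) # ys" E c d zs]
      by simp
  qed
qed

text \<open>The terms \<open>(j, i)\<close> with \<open>i < j\<close> and \<open>(i, j - 1)\<close> carry opposite signs and equal faces.\<close>

lemma coboundary_coboundary: "coboundary E (Suc n) (coboundary E n \<alpha>) = 0"
proof
  fix as
  show "coboundary E (Suc n) (coboundary E n \<alpha>) as = 0 as"
  proof (cases "as \<in> tests E (Suc (Suc n))")
    case False
    then show ?thesis by (simp add: coboundary_def)
  next
    case True
    define f where "f = (\<lambda>(j, i). (- 1) ^ j * ((- 1) ^ i * \<alpha> (cface E i (cface E j as))))"
    define S where "S = {(j, i). i < j \<and> j \<le> Suc (Suc n)}"
    define T where "T = {(j, i). j \<le> i \<and> i \<le> Suc n}"
    have "S \<subseteq> {..Suc (Suc n)} \<times> {..Suc n}" "T \<subseteq> {..Suc (Suc n)} \<times> {..Suc n}"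
      by (auto simp: S_def T_def)
    then have fin: "finite S" "finite T" by (meson finite_SigmaI finite_atMost finite_subset)+
    have ST: "{..Suc (Suc n)} \<times> {..Suc n} = S \<union> T" "S \<inter> T = {}"
      by (auto simp: S_def T_def)
    have "coboundary E (Suc n) (coboundary E n \<alpha>) as = (\<Sum>j\<le>Suc (Suc n). \<Sum>i\<le>Suc n. f (j, i))"
      using True cface_tests[OF True]
      by (simp add: coboundary_eq_sum sum_distrib_left f_def del: sum.atMost_Suc)
    also have "\<dots> = sum f S + sum f T"
      using fin ST by (simp add: sum.cartesian_product sum.union_disjoint del: sum.atMost_Suc)
    also have "sum f S = sum (\<lambda>x. - f x) T"
    \<comment> \<open>On \<open>S\<close> the outer index j is positive, so j - 1 is a genuine
      predecessor, and i < j \<le> n + 2 becomes i \<le> j - 1 \<le> n + 1, the condition defining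
      \<open>T\<close>.\<close>
    proof (rule sum.reindex_bij_witness[where i = "\<lambda>(i, j). (Suc j, i)" and j = "\<lambda>(j, i). (i, j - 1)"])
      show "- f (case x of (j, i) \<Rightarrow> (i, j - 1)) = f x" if "x \<in> S" for x
      proof -
        obtain j i where x: "x = (Suc j, i)" "i \<le> j" "Suc j \<le> Suc (Suc n)"
          using \<open>x \<in> S\<close> by (cases "fst x") (auto simp: S_def)
        then show ?thesis
          using cface_cface[OF True, of i "Suc j"] by (simp add: f_def)
      qed
    qed (auto simp: S_def T_def)
    finally show ?thesis by (simp add: sum_negf)
  qed
qed

end

section \<open>The order complex as a complex of ordered groups\<close>

lemma ordered_cochain_complex_order_complex:
  assumes "effect_algebra E"
  shows "ordered_cochain_complex (order_complex E)"
proof -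
  interpret effect_algebra E by fact
  have zero: "0 \<in> cochains E n" "0 \<in> cochains_prev E n" for n
    by (auto simp: cochains_prev_def cochains_def split: nat.split)
  have diff: "\<alpha> - \<beta> \<in> cochains E n" if "\<alpha> \<in> cochains E n" "\<beta> \<in> cochains E n" for \<alpha> \<beta> n
    using that by (auto simp: cochains_def)
  have diff_prev: "\<alpha> - \<beta> \<in> cochains_prev E n"
    if "\<alpha> \<in> cochains_prev E n" "\<beta> \<in> cochains_prev E n" for \<alpha> \<beta> n
    using that diff by (cases n) (auto simp: cochains_prev_def)
  have cob: "coboundary E n \<alpha> \<in> cochains E (Suc n)" for \<alpha> n
    by (auto simp: coboundary_def cochains_def)
  have cob_prev: "coboundary_prev E n \<alpha> \<in> cochains E n" for \<alpha> n
    using cob zero by (cases n) (auto simp: coboundary_prev_def)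
  have cob_diff: "coboundary E n (\<alpha> - \<beta>) = coboundary E n \<alpha> - coboundary E n \<beta>" for \<alpha> \<beta> n
    by (auto simp: coboundary_def sum_subtractf algebra_simps)
  have cob_prev_diff: "coboundary_prev E n (\<alpha> - \<beta>) = coboundary_prev E n \<alpha> - coboundary_prev E n \<beta>"
    for \<alpha> \<beta> n
    by (cases n) (auto simp: coboundary_prev_def cob_diff)
  have prev_Suc: "coboundary_prev E (Suc n) \<alpha> = coboundary E n \<alpha>" for \<alpha> n
    by (simp add: coboundary_prev_def)
  \<comment> \<open>In the second component of the squared coboundary the two copies of the
    coboundary of \<phi> cancel, leaving exactly this term in \<psi>.\<close>
  have cob_cob_prev: "coboundary E n (coboundary_prev E n \<alpha>) = 0" for \<alpha> n
  proof (cases n)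
    case 0
    then show ?thesis by (auto simp: coboundary_prev_def coboundary_def)
  next
    case (Suc m)
    then show ?thesis by (simp add: coboundary_prev_def coboundary_coboundary)
  qed
  show ?thesis
  proof
    fix n and x y :: "('a list \<Rightarrow> real) \<times> ('a list \<Rightarrow> real)"
    obtain \<phi> \<psi> \<phi>' \<psi>' where xy: "x = (\<phi>, \<psi>)" "y = (\<phi>', \<psi>')" by fastforce
    show "0 \<in> grp (order_complex E) n"
      by (simp add: order_complex_def zero zero_prod_def)
    show "x - y \<in> grp (order_complex E) n"
      if "x \<in> grp (order_complex E) n" "y \<in> grp (order_complex E) n"
      using that by (simp add: order_complex_def xy diff diff_prev)
    show "cobd (order_complex E) n (x - y) = cobd (order_complex E) n x - cobd (order_complex E) n y"
      by (simp add: order_complex_def xy cob_diff cob_prev_diff)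
    show "cobd (order_complex E) n x \<in> grp (order_complex E) (Suc n)"
      if "x \<in> grp (order_complex E) n"
      using that by (simp add: order_complex_def xy cob cob_prev diff cochains_prev_def)
    show "cobd (order_complex E) (Suc n) (cobd (order_complex E) n x) = 0"
      by (simp add: order_complex_def xy coboundary_coboundary prev_Suc cob_diff
          cob_cob_prev zero_prod_def)
    show "leq (order_complex E) n x x"
      by (simp add: order_complex_def xy zero zero_prod_def)
    show "leq (order_complex E) n x y \<longleftrightarrow> leq (order_complex E) n 0 (y - x)"
      by (simp add: order_complex_def)
  qed
qed


section \<open>Restriction along a morphism\<close>

lemma ea_morphism_osum:
  "\<lbrakk>ea_morphism E F i; a \<in> carrier E; b \<in> carrier E; osum E a b = Some c\<rbrakk>
    \<Longrightarrow> osum F (i a) (i b) = Some (i c)"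
  by (auto simp: ea_morphism_def)

lemma (in effect_algebra) map_tests:
  assumes i: "ea_morphism E F i" and as: "as \<in> tests E n"
  shows "map i as \<in> tests F n"
proof -
  \<comment> \<open>\<open>osum_list\<close> replaces the first two entries by their sum, so the
    head has to vary during the induction on the tail.\<close>
  have sum: "osum_list F (map i (a # as)) = Some (i c)"
    if "set (a # as) \<subseteq> carrier E" "osum_list E (a # as) = Some c" for a as c
    using that
  proof (induction as arbitrary: a)
    case (Cons b as)
    from Cons.prems(2) obtain d where d: "osum E a b = Some d" "osum_list E (d # as) = Some c"
      by (auto simp: bind_eq_Some_conv)
    have "d \<in> carrier E" using Cons.prems(1) d(1) osum_closed[of a b d] by simp
    then show ?case
      using Cons.IH[of d] Cons.prems(1) d ea_morphism_osum[OF i _ _ d(1)] by simp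
  qed simp
  obtain a bs where "as = a # bs" using as by (cases as) (auto simp: tests_def)
  with sum[of a bs "one E"] show ?thesis
    using i as by (auto simp: tests_def ea_morphism_def)
qed

text \<open>A morphism respects defined sums only. In a test the merged pair is always summable, so
  \<open>the\<close> is applied to a genuine value on both sides.\<close>

lemma (in effect_algebra) map_cface:
  assumes i: "ea_morphism E F i" and as: "as \<in> tests E (Suc n)" and k: "k \<le> Suc n"
  shows "map i (cface E k as) = cface F k (map i as)"
proof (cases "k = Suc n")
  case True
  have len: "length as = Suc (Suc n)" using as by (simp add: tests_def)
  then have "2 \<le> length as" by simp
  then obtain a xs b where s: "as = a # xs @ [b]" by (rule list_split_ends)
  obtain d where "osum E b a = Some d"
    using as s by (auto elim: tests_merge_cyclic)
  moreover from this have "osum F (i b) (i a) = Some (i d)"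
    using as s i by (auto simp: tests_def intro: ea_morphism_osum)
  ultimately show ?thesis
    using len True s cface_cyclic[of k "map i xs" F "i a" "i b"] by (simp add: cface_cyclic)
next
  case False
  then have "Suc k < length as" using as k by (simp add: tests_def)
  then obtain xs a b ys where s: "as = xs @ a # b # ys" "length xs = k" by (rule list_split_pair)
  obtain d where "osum E a b = Some d"
    using as s by (auto elim: tests_merge)
  moreover from this have "osum F (i a) (i b) = Some (i d)"
    using as s i by (auto simp: tests_def intro: ea_morphism_osum)
  ultimately show ?thesis
    using s cface_append[of k "map i xs" F "i a" "i b"] by (simp add: cface_append)
qed

lemma (in effect_algebra) restrict_coboundary:
  assumes "ea_morphism E F i"
  shows "restrict_cochain E i (Suc n) (coboundary F n \<alpha>) = coboundary E n (restrict_cochain E i n \<alpha>)"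
proof
  fix as
  show "restrict_cochain E i (Suc n) (coboundary F n \<alpha>) as = coboundary E n (restrict_cochain E i n \<alpha>) as"
  proof (cases "as \<in> tests E (Suc n)")
    case True
    then show ?thesis
      using assms
      by (simp add: restrict_cochain_def coboundary_eq_sum map_tests cface_tests map_cface
          del: sum.atMost_Suc)
  qed (simp add: restrict_cochain_def coboundary_def)
qed

lemma restrict_cochain_surj:
  assumes E: "effect_algebra E" and i: "ea_morphism E F i" "inj_on i (carrier E)"
    and \<alpha>: "\<alpha> \<in> cochains E n"
  shows "\<exists>\<beta>\<in>cochains F n. restrict_cochain E i n \<beta> = \<alpha>"
proof -
  \<comment> \<open>Extension by zero from the image of the tests of E; injectivity of i makes
    \<open>map i\<close> invertible there.\<close>
  define \<beta> where "\<beta> = (\<lambda>bs. if bs \<in> map i ` tests E n then \<alpha> (inv_into (tests E n) (map i) bs) else 0)"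
  have "inj_on (map i) (tests E n)"
    by (intro inj_onI, elim map_inj_on) (auto simp: tests_def intro: inj_on_subset[OF i(2)])
  then have "restrict_cochain E i n \<beta> = \<alpha>"
    using \<alpha> by (auto simp: restrict_cochain_def \<beta>_def cochains_def)
  moreover have "\<beta> \<in> cochains F n"
    using effect_algebra.map_tests[OF E i(1)] by (auto simp: \<beta>_def cochains_def)
  ultimately show ?thesis by blast
qed

lemma surjective_complex_morphism_order_restrict:
  assumes E: "effect_algebra E" and F: "effect_algebra F"
    and i: "ea_morphism E F i" "inj_on i (carrier E)"
  shows "surjective_complex_morphism (order_complex F) (order_complex E) (order_restrict E i)"
proof -
  interpret E: effect_algebra E by fact
  interpret A: ordered_cochain_complex "order_complex E"
    using E by (rule ordered_cochain_complex_order_complex)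
  interpret B: ordered_cochain_complex "order_complex F"
    using F by (rule ordered_cochain_complex_order_complex)
  have diff: "restrict_cochain E i n (\<alpha> - \<beta>) = restrict_cochain E i n \<alpha> - restrict_cochain E i n \<beta>"
    for n \<alpha> \<beta>
    by (auto simp: restrict_cochain_def)
  have zero: "restrict_cochain E i n 0 = 0" for n
    by (auto simp: restrict_cochain_def)
  show ?thesis
  proof
    fix n and x y :: "('b list \<Rightarrow> real) \<times> ('b list \<Rightarrow> real)"
    obtain \<phi> \<psi> \<phi>' \<psi>' where xy: "x = (\<phi>, \<psi>)" "y = (\<phi>', \<psi>')" by fastforce
    show "order_restrict E i n (x - y) = order_restrict E i n x - order_restrict E i n y"
      by (cases n) (simp_all add: order_restrict_def xy diff)
    show "order_restrict E i (Suc n) (cobd (order_complex F) n x) =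
        cobd (order_complex E) n (order_restrict E i n x)"
      by (cases n) (simp_all add: order_restrict_def order_complex_def xy diff zero
          coboundary_prev_def E.restrict_coboundary[OF i(1)])
  next
    fix n a
    assume "a \<in> grp (order_complex E) n"
    then show "\<exists>b\<in>grp (order_complex F) n. order_restrict E i n b = a"
      using restrict_cochain_surj[OF E i]
      by (cases n) (fastforce simp: order_complex_def order_restrict_def cochains_prev_def)+
  qed
qed


section \<open>States as cocycles\<close>

text \<open>The remaining clauses of a morphism are consequences: adding a to its complement yields
  the complement rule and hence the bound s a \<le> 1, and 0 + 0 = 0 yields the value at
  zero.\<close>

lemma ea_state_iff:
  assumes E: "effect_algebra E"
  shows "ea_state E s \<longleftrightarrow>
    (\<forall>a\<in>carrier E. 0 \<le> s a) \<and> s (one E) = 1 \<and>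
    (\<forall>a\<in>carrier E. \<forall>b\<in>carrier E. \<forall>c. osum E a b = Some c \<longrightarrow> s c = s a + s b)"
    (is "_ \<longleftrightarrow> ?R")
proof
  assume s: "ea_state E s"
  have "s c = s a + s b" if "a \<in> carrier E" "b \<in> carrier E" "osum E a b = Some c" for a b c
  proof -
    have "osum unit_interval (s a) (s b) = Some (s c)"
      using s that by (auto simp: ea_state_def ea_morphism_def)
    then show ?thesis by (simp add: unit_interval_def split: if_splits)
  qed
  moreover have "0 \<le> s a" if "a \<in> carrier E" for a
    using s that by (auto simp: ea_state_def ea_morphism_def unit_interval_def image_subset_iff)
  moreover have "s (one E) = 1"
    using s by (simp add: ea_state_def ea_morphism_def unit_interval_def)
  ultimately show ?R by blast
next
  interpret effect_algebra E by fact
  assume R: ?R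
  have nonneg: "0 \<le> s a" if "a \<in> carrier E" for a
    using R that by blast
  have add: "s c = s a + s b" if "a \<in> carrier E" "b \<in> carrier E" "osum E a b = Some c" for a b c
    using R that by blast
  have one: "s (one E) = 1"
    using R by blast
  have compl: "s (compl E a) = 1 - s a" if "a \<in> carrier E" for a
    using add[OF that compl_closed[OF that] osum_compl[OF that]] one by simp
  have le1: "s a \<le> 1" if "a \<in> carrier E" for a
    using compl[OF that] nonneg[OF compl_closed[OF that]] by simp
  have "s (zero E) = 0"
    using add[OF zero_closed zero_closed osum_zero[OF zero_closed]] by simp
  moreover have "s a + s b = s c \<and> s a + s b \<le> 1"
    if "a \<in> carrier E" "b \<in> carrier E" "osum E a b = Some c" for a b c
    using add[OF that] le1[OF osum_closed[OF that]] by simp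
  ultimately show "ea_state E s"
    using nonneg le1 one compl
    by (auto simp: ea_state_def ea_morphism_def unit_interval_def image_subset_iff dest: osum_closed)
qed

definition test_cochain :: "'a effect_alg \<Rightarrow> ('a \<Rightarrow> real) \<Rightarrow> 'a list \<Rightarrow> real" where
  "test_cochain E s = (\<lambda>as. if as \<in> tests E 1 then s (as ! 1) else 0)"

section \<open>Tests and coboundaries in low degrees\<close>

context effect_algebra
begin

lemma tests_0: "tests E 0 = {[one E]}"
  by (auto simp: tests_def length_Suc_conv one_closed)

lemma tests_1: "as \<in> tests E (Suc 0) \<longleftrightarrow> (\<exists>a\<in>carrier E. as = [compl E a, a])"
proof
  assume "as \<in> tests E (Suc 0)"
  then obtain b a where as: "as = [b, a]" and ba: "b \<in> carrier E" "a \<in> carrier E"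
    "osum E b a = Some (one E)"
    by (auto simp: tests_def length_Suc_conv bind_eq_Some_conv)
  have "b = compl E a"
    using ba(2,1) osum_commute[OF ba] by (rule compl_unique)
  with as ba show "\<exists>a\<in>carrier E. as = [compl E a, a]" by blast
next
  assume "\<exists>a\<in>carrier E. as = [compl E a, a]"
  then obtain a where as: "as = [compl E a, a]" and a: "a \<in> carrier E" by blast
  have "osum E (compl E a) a = Some (one E)"
    using a compl_closed[OF a] osum_compl[OF a] by (rule osum_commute)
  with as a show "as \<in> tests E (Suc 0)"
    by (simp add: tests_def compl_closed)
qed

lemma tests_2I:
  assumes "a \<in> carrier E" "b \<in> carrier E" "osum E a b = Some c"
  shows "[compl E c, a, b] \<in> tests E (Suc (Suc 0))"
proof -
  have c: "c \<in> carrier E" using assms osum_closed by blast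
  have "osum_list E ([compl E c] @ [a, b]) = oadd (Some (compl E c)) (Some c)"
    using assms c compl_closed by (subst osum_list_append) auto
  also have "\<dots> = osum E c (compl E c)"
    using c compl_closed by (simp add: oadd_commute[of "Some (compl E c)"] oadd_Some)
  also have "\<dots> = Some (one E)"
    using c by (rule osum_compl)
  finally show ?thesis using assms c compl_closed by (auto simp: tests_def)
qed

text \<open>The faces are tests of degree 1, hence determined by their last entry: face 0 ends in c
  and the cyclic face ends in b. The middle face ends in the sum of b and c, which is named
  \<open>bc\<close>.\<close>

lemma coboundary_1:
  assumes "[a, b, c] \<in> tests E (Suc (Suc 0))"
    and "[compl E bc, bc] = cface E 1 [a, b, c]"
  shows "coboundary E (Suc 0) \<alpha> [a, b, c] =
    \<alpha> [compl E c, c] - \<alpha> [compl E bc, bc] + \<alpha> [compl E b, b]"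
proof -
  have "cface E 0 [a, b, c] \<in> tests E (Suc 0)" "cface E 2 [a, b, c] \<in> tests E (Suc 0)"
    using assms(1) by (auto intro: cface_tests)
  then have "cface E 0 [a, b, c] = [compl E c, c]" "cface E 2 [a, b, c] = [compl E b, b]"
    by (auto simp: cface_def face_def cyclic_face_def tests_1)
  with assms show ?thesis
    by (simp add: coboundary_eq_sum numeral_2_eq_2)
qed

lemma coboundary_test:
  assumes "a \<in> carrier E" "b \<in> carrier E" "osum E a b = Some c"
  shows "coboundary E (Suc 0) \<alpha> [compl E c, a, b] =
    \<alpha> [compl E b, b] - \<alpha> [compl E c, c] + \<alpha> [compl E a, a]"
  using tests_2I[OF assms] assms(3)
  by (intro coboundary_1) (auto simp: cface_def face_def)

text \<open>Merging the last two entries leaves a test of degree 1, which forces the first entry to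
  be the complement of their sum. Tests of degree 2 thus correspond to summable pairs.\<close>

lemma tests_2E:
  assumes "as \<in> tests E (Suc (Suc 0))"
  obtains a b c where "a \<in> carrier E" "b \<in> carrier E" "osum E a b = Some c"
    "as = [compl E c, a, b]"
proof -
  obtain d a b where as: "as = [d, a, b]" and ab: "a \<in> carrier E" "b \<in> carrier E"
    using assms by (auto simp: tests_def length_Suc_conv)
  then obtain c where c: "osum E a b = Some c" "[d, c] \<in> tests E (Suc 0)"
    using tests_merge[of "[d]" a b "[]" "Suc 0"] assms by auto
  then have "d = compl E c" by (auto simp: tests_1)
  with that as ab c show ?thesis by blast
qed

text \<open>The value of the coboundary on the test of a summable pair is its additivity defect, and
  every test of degree 2 arises from such a pair.\<close>

lemma coboundary_1_eq_0_iff: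
  "coboundary E (Suc 0) \<alpha> = 0 \<longleftrightarrow>
    (\<forall>a\<in>carrier E. \<forall>b\<in>carrier E. \<forall>c. osum E a b = Some c \<longrightarrow>
      \<alpha> [compl E c, c] = \<alpha> [compl E a, a] + \<alpha> [compl E b, b])" (is "?L \<longleftrightarrow> ?R")
proof
  assume ?L
  show ?R
  proof (intro ballI allI impI)
    fix a b c assume "a \<in> carrier E" "b \<in> carrier E" "osum E a b = Some c"
    then show "\<alpha> [compl E c, c] = \<alpha> [compl E a, a] + \<alpha> [compl E b, b]"
      using coboundary_test[of a b c \<alpha>] \<open>?L\<close> by simp
  qed
next
  assume ?R
  show ?L
  proof
    fix as
    show "coboundary E (Suc 0) \<alpha> as = 0 as"
    proof (cases "as \<in> tests E (Suc (Suc 0))")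
      case True
      then obtain a b c where *: "a \<in> carrier E" "b \<in> carrier E" "osum E a b = Some c"
        "as = [compl E c, a, b]"
        by (rule tests_2E)
      with \<open>?R\<close> have "\<alpha> [compl E c, c] = \<alpha> [compl E a, a] + \<alpha> [compl E b, b]" by blast
      with * show ?thesis by (simp add: coboundary_test)
    qed (simp add: coboundary_def)
  qed
qed

lemma test_cochain_eq: "a \<in> carrier E \<Longrightarrow> test_cochain E s [compl E a, a] = s a"
  by (auto simp: test_cochain_def tests_1)

text \<open>The only test of degree 0 is \<open>[one E]\<close>, so \<psi> vanishes. The positive
  cone is zero in the first factor and pointwise in the second, which separates the cocycle equation
  from non-negativity.\<close>

lemma leq_cobd_1_iff:
  assumes "(\<phi>, \<psi>) \<in> grp (order_complex E) 1" "\<psi> [one E] = 0"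
  shows "leq (order_complex E) 2 0 (cobd (order_complex E) 1 (\<phi>, \<psi>)) \<longleftrightarrow>
    \<psi> = 0 \<and> 0 \<le> \<phi> \<and> coboundary E 1 \<phi> = 0"
proof -
  have \<phi>: "\<phi> \<in> cochains E 1" and "\<psi> \<in> cochains E 0"
    using assms(1) by (simp_all add: order_complex_def cochains_prev_def)
  then have "\<psi> as = 0" for as
    using assms(2) by (cases "as = [one E]") (simp_all add: cochains_def tests_0)
  then have \<psi>: "\<psi> = 0" by auto
  have "coboundary E 0 0 = 0"
    by (auto simp: coboundary_def)
  then have "cobd (order_complex E) 1 (\<phi>, \<psi>) = (coboundary E 1 \<phi>, \<phi>)"
    by (simp add: order_complex_def coboundary_prev_def \<psi>)
  then show ?thesis
    using \<phi> \<psi> by (auto simp: order_complex_def cochains_prev_def numeral_2_eq_2)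
qed

lemma test_cochain_state:
  assumes "ea_state E s"
  shows "test_cochain E s \<in> cochains E 1" "0 \<le> test_cochain E s"
    "coboundary E 1 (test_cochain E s) = 0"
proof -
  show "test_cochain E s \<in> cochains E 1"
    by (simp add: test_cochain_def cochains_def)
  show "0 \<le> test_cochain E s"
    using assms ea_state_iff[OF effect_algebra_axioms, of s]
    by (auto simp: le_fun_def test_cochain_def tests_1)
  show "coboundary E 1 (test_cochain E s) = 0"
    unfolding One_nat_def coboundary_1_eq_0_iff
  proof (intro ballI allI impI)
    fix a b c
    assume "a \<in> carrier E" "b \<in> carrier E" "osum E a b = Some c"
    moreover from this have "s c = s a + s b" "c \<in> carrier E"
      using assms ea_state_iff[OF effect_algebra_axioms, of s] osum_closed[of a b c] by blast+
    ultimately show "test_cochain E s [compl E c, c] =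
        test_cochain E s [compl E a, a] + test_cochain E s [compl E b, b]"
      by (simp add: test_cochain_eq)
  qed
qed

lemma grp_test_cochain:
  "ea_state E s \<Longrightarrow> (test_cochain E s, 0) \<in> grp (order_complex E) 1"
  using test_cochain_state by (auto simp: order_complex_def cochains_prev_def cochains_def)

lemma leq_cobd_test_cochain:
  "ea_state E s \<Longrightarrow> leq (order_complex E) 2 0 (cobd (order_complex E) 1 (test_cochain E s, 0))"
  using leq_cobd_1_iff[OF grp_test_cochain] test_cochain_state by auto

end

section \<open>Extension of states and the connecting homomorphism\<close>

theorem theorem10p5:
  fixes E :: "'a effect_alg" and F :: "'b effect_alg"
    and i :: "'a \<Rightarrow> 'b" and \<sigma> :: "'a \<Rightarrow> real"
  assumes "effect_algebra E" and "effect_algebra F"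
    and "ea_morphism E F i" and "inj_on i (carrier E)"
    and "ea_state E \<sigma>"
  shows "(\<exists>\<tau>. ea_state F \<tau> \<and> (\<forall>a\<in>carrier E. \<tau> (i a) = \<sigma> a)) \<longleftrightarrow>
    additive_class E \<sigma> \<in>
      precone (cohom (order_complex E) 1)
        (rel_cohom_leq (order_complex F) (order_complex E) (order_restrict E i) 2)
        (rel_cohom_class (order_complex F) (order_complex E) (order_restrict E i) 2 0)
        (connecting (order_complex F) (order_complex E) (order_restrict E i) 1)"
    (is "?ext \<longleftrightarrow> ?precone")
proof -
  interpret E: effect_algebra E by fact
  interpret F: effect_algebra F by fact
  interpret surjective_complex_morphism "order_complex F" "order_complex E" "order_restrict E i"
    using assms(1-4) by (rule surjective_complex_morphism_order_restrict)
  let ?s = "(test_cochain E \<sigma>, 0)"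
  have "?s \<in> cocycles (order_complex E) 1"
    using E.grp_test_cochain E.leq_cobd_test_cochain assms(5)
    by (simp add: cocycles_def precone_def numeral_2_eq_2)
  from cohom_class_mem_precone_connecting_iff[OF this]
  have "?precone \<longleftrightarrow> (\<exists>b\<in>grp (order_complex F) 1. order_restrict E i 1 b = ?s \<and>
      leq (order_complex F) 2 0 (cobd (order_complex F) 1 b))" (is "_ \<longleftrightarrow> ?lift")
    by (simp add: additive_class_def test_cochain_def numeral_2_eq_2)
  moreover have "?ext \<longleftrightarrow> ?lift"
  proof
    assume ?ext
    then obtain \<tau> where \<tau>: "ea_state F \<tau>" "\<And>a. a \<in> carrier E \<Longrightarrow> \<tau> (i a) = \<sigma> a" by blast
    \<comment> \<open>The lift is the cochain of \<tau> itself: \<open>map i\<close> sends tests of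
      E to tests of F, and the entry read off there is \<open>i a\<close>.\<close>
    have "restrict_cochain E i 1 (test_cochain F \<tau>) = test_cochain E \<sigma>"
      using \<tau>(2) E.map_tests[OF assms(3)]
      by (auto simp: fun_eq_iff restrict_cochain_def test_cochain_def E.tests_1)
    then show ?lift
      using F.grp_test_cochain[OF \<tau>(1)] F.leq_cobd_test_cochain[OF \<tau>(1)]
      by (intro bexI[of _ "(test_cochain F \<tau>, 0)"])
         (auto simp: order_restrict_def restrict_cochain_def)
  next
    assume ?lift
    then obtain \<phi> \<psi> where grp: "(\<phi>, \<psi>) \<in> grp (order_complex F) 1"
      and res: "restrict_cochain E i 1 \<phi> = test_cochain E \<sigma>" "restrict_cochain E i 0 \<psi> = 0"
      and le: "leq (order_complex F) 2 0 (cobd (order_complex F) 1 (\<phi>, \<psi>))"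
      by (auto simp: order_restrict_def)
    \<comment> \<open>The single test of degree 0 of F is the image of that of E because i preserves
      the unit, so the restriction of \<psi> already controls its value.\<close>
    have "\<psi> [one F] = 0"
      using fun_cong[OF res(2), of "[one E]"] assms(3)
      by (simp add: restrict_cochain_def E.tests_0 ea_morphism_def)
    then have \<phi>: "0 \<le> \<phi>" "coboundary F 1 \<phi> = 0"
      using F.leq_cobd_1_iff grp le by auto
    let ?\<tau> = "\<lambda>a. \<phi> [compl F a, a]"
    have ext: "?\<tau> (i a) = \<sigma> a" if "a \<in> carrier E" for a
    proof -
      have "[compl E a, a] \<in> tests E 1" using that by (auto simp: E.tests_1)
      then show ?thesis
        using fun_cong[OF res(1), of "[compl E a, a]"] that assms(3)
        by (simp add: restrict_cochain_def E.test_cochain_eq ea_morphism_def)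
    qed
    \<comment> \<open>Positivity of the coboundary yields a non-negative additive function; its
      normalisation is inherited from \<sigma> through the unit of E.\<close>
    have "?\<tau> (one F) = 1"
      using ext[OF E.one_closed] assms(3,5) by (simp add: ea_morphism_def ea_state_def unit_interval_def)
    then have "ea_state F ?\<tau>"
      using \<phi> by (simp add: ea_state_iff[OF assms(2)] F.coboundary_1_eq_0_iff le_fun_def)
    with ext show ?ext by blast
  qed
  ultimately show ?thesis by simp
qed

end
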